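(* Let $\psi:[1,\infty)\to(0,\infty)$ be a measurable function bounded from below by a positive constant, let $\xi$ be a centered random variable with $\xi\in G\psi$, and let $\xi_1,\xi_2,\ldots$ be independent copies of $\xi$. Put $$\psi_R(p)=C_R\,\frac{p}{e\,\ln p}\,\psi(p),\qquad p\ge2 .$$ Then $$\sup_{n\ge1}\ \sup_{(a_1,\ldots,a_n)\in D(n)}\ \Big\|\sum_{k=1}^n a_k\xi_k\Big\|_{G\psi_R}\le\|\xi\|_{G\psi} .$$
   Context: All random variables are real-valued and defined on a sufficiently rich probability space; $\|\eta\|_p=(\mathbf{E}|\eta|^p)^{1/p}$. For $n\ge1$, $D(n)=\{(a_1,\ldots,a_n)\in\mathbb{R}^n:\ \sum_{k=1}^n a_k^2=1\}$. For a generating function $\psi$, the Grand Lebesgue Space $G\psi$ consists of the random variables $\zeta$ with finite norm $\|\zeta\|_{G\psi}=\sup_{p\ge2}\|\zeta\|_p/\psi(p)$; the norm $\|\cdot\|_{G\psi_R}$ is defined in the same way with $\psi_R$ in place of $\psi$. $C_R$ is the numerical constant, $C_R\approx1.776379<1.77638$, in the known bound for the Rosenthal inequality: for every $p\ge2$, every $n\ge1$ and all independent centered random variables $\eta_1,\ldots,\eta_n$ with finite $p$-th absolute moments, $$\Big\|\sum_{j=1}^n\eta_j\Big\|_p\le C_R\,\frac{p}{e\ln p}\,\max\Big(\Big\|\sum_{j=1}^n\eta_j\Big\|_2,\ \Big(\sum_{j=1}^n\|\eta_j\|_p^p\Big)^{1/p}\Big).$$ This known inequality may be taken as given. *)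

theory Defs
  imports "HOL-Probability.Probability"
begin

text \<open>Real powers of extended nonnegative reals; meant for exponents \<open>r > 0\<close>, where
  \<open>\<infinity>\<close> to the power \<open>r\<close> is \<open>\<infinity>\<close>.\<close>

definition epowr :: "ennreal \<Rightarrow> real \<Rightarrow> ennreal" where
  "epowr x r = (if x = \<top> then \<top> else ennreal (enn2real x powr r))"

text \<open>Moments and norms take values in \<open>[0, \<infinity>]\<close>, so that they are meaningful for random
  variables without finite moments too.\<close>

definition Lp_norm :: "'a measure \<Rightarrow> real \<Rightarrow> ('a \<Rightarrow> real) \<Rightarrow> ennreal" where
  "Lp_norm M p \<eta> = epowr (\<integral>\<^sup>+ \<omega>. ennreal (\<bar>\<eta> \<omega>\<bar> powr p) \<partial>M) (1 / p)"

definition centered :: "'a measure \<Rightarrow> ('a \<Rightarrow> real) \<Rightarrow> bool" where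
  "centered M \<eta> \<longleftrightarrow> integrable M \<eta> \<and> (\<integral>\<omega>. \<eta> \<omega> \<partial>M) = 0"

text \<open>Only the values of \<open>\<psi>\<close> on \<open>[1, \<infinity>)\<close> are relevant.\<close>

definition generating_function :: "(real \<Rightarrow> real) \<Rightarrow> bool" where
  "generating_function \<psi> \<longleftrightarrow>
     (\<forall>p\<ge>1. 0 < \<psi> p) \<and>
     \<psi> \<in> borel_measurable (restrict_space borel {1..}) \<and>
     (\<exists>c>0. \<forall>p\<ge>1. c \<le> \<psi> p)"

definition GLS_norm :: "'a measure \<Rightarrow> (real \<Rightarrow> real) \<Rightarrow> ('a \<Rightarrow> real) \<Rightarrow> ennreal" where
  "GLS_norm M \<psi> \<zeta> = (SUP p\<in>{2..}. Lp_norm M p \<zeta> / ennreal (\<psi> p))"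

definition GLS :: "'a measure \<Rightarrow> (real \<Rightarrow> real) \<Rightarrow> ('a \<Rightarrow> real) set" where
  "GLS M \<psi> = {\<zeta> \<in> borel_measurable M. GLS_norm M \<psi> \<zeta> < \<infinity>}"

text \<open>Vectors of \<open>\<real>\<^sup>n\<close> are functions on \<open>{1..n}\<close>, extended by \<open>undefined\<close> elsewhere.\<close>

definition D :: "nat \<Rightarrow> (nat \<Rightarrow> real) set" where
  "D n = {a \<in> extensional {1..n}. (\<Sum>k=1..n. (a k)\<^sup>2) = 1}"

text \<open>\<open>C\<close> is an admissible constant in the Rosenthal inequality on the probability space \<open>M\<close>.
  The numerical constant \<open>C\<^sub>R \<approx> 1.776379\<close> is known to be admissible on every probability space.\<close>

definition Rosenthal_constant :: "'a measure \<Rightarrow> real \<Rightarrow> bool" where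
  "Rosenthal_constant M C \<longleftrightarrow> 0 < C \<and>
     (\<forall>p\<ge>2. \<forall>n\<ge>1. \<forall>\<eta> :: nat \<Rightarrow> 'a \<Rightarrow> real.
        prob_space.indep_vars M (\<lambda>_. borel) \<eta> {1..n} \<longrightarrow>
        (\<forall>j\<in>{1..n}. centered M (\<eta> j) \<and> Lp_norm M p (\<eta> j) < \<infinity>) \<longrightarrow>
        Lp_norm M p (\<lambda>\<omega>. \<Sum>j=1..n. \<eta> j \<omega>)
          \<le> ennreal (C * (p / (exp 1 * ln p))) *
             max (Lp_norm M 2 (\<lambda>\<omega>. \<Sum>j=1..n. \<eta> j \<omega>))
                 (epowr (\<Sum>j=1..n. epowr (Lp_norm M p (\<eta> j)) p) (1 / p)))"

definition psi_R :: "real \<Rightarrow> (real \<Rightarrow> real) \<Rightarrow> real \<Rightarrow> real" where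
  "psi_R C \<psi> p = C * (p / (exp 1 * ln p)) * \<psi> p"

end

theory Submission
  imports Defs
begin

text \<open>For fixed \<open>p\<close>, apply the Rosenthal inequality to the variables \<open>a\<^sub>k \<xi>\<^sub>k\<close>, \<open>a \<in> D n\<close>. The
  variance of their sum is that of \<open>\<xi>\<close>, so the first term of the maximum is \<open>\<parallel>\<xi>\<parallel>\<^sub>2 \<le> \<parallel>\<xi>\<parallel>\<^sub>p\<close>; since
  \<open>\<bar>a\<^sub>k\<bar> \<le> 1\<close> and \<open>p \<ge> 2\<close>, we have \<open>\<Sum> \<bar>a\<^sub>k\<bar>\<^sup>p \<le> 1\<close> and the second term is at most \<open>\<parallel>\<xi>\<parallel>\<^sub>p\<close> too.
  Dividing by \<open>\<psi>\<^sub>R p\<close> cancels the Rosenthal factor.\<close>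

section \<open>Norms as real integrals, dependence on the law, scaling\<close>

lemma epowr_ennreal: "0 \<le> x \<Longrightarrow> epowr (ennreal x) r = ennreal (x powr r)"
  by (simp add: epowr_def)

lemma Lp_norm_eq_integral:
  assumes "integrable M (\<lambda>\<omega>. \<bar>f \<omega>\<bar> powr p)"
  shows "Lp_norm M p f = ennreal ((\<integral>\<omega>. \<bar>f \<omega>\<bar> powr p \<partial>M) powr (1 / p))"
  using assms by (simp add: Lp_norm_def nn_integral_eq_integral epowr_ennreal integral_nonneg_AE)

text \<open>\<open>epowr\<close> takes the value \<open>\<top>\<close> only at
  \<open>\<top>\<close>, so a finite norm forces a finite moment.\<close>

lemma integrable_powr_if_Lp_norm_finite:
  assumes [measurable]: "f \<in> borel_measurable M" and "Lp_norm M p f < \<infinity>"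
  shows "integrable M (\<lambda>\<omega>. \<bar>f \<omega>\<bar> powr p)"
proof (rule integrableI_nonneg)
  show "(\<integral>\<^sup>+ \<omega>. ennreal (\<bar>f \<omega>\<bar> powr p) \<partial>M) < \<infinity>"
    using assms(2) by (auto simp: Lp_norm_def epowr_def less_top split: if_splits)
qed auto

text \<open>By change of variables, the moment is an integral against the law alone. This carries
  norms from \<open>\<xi>\<close> to its copies.\<close>

lemma Lp_norm_distr_cong:
  assumes [measurable]: "X \<in> borel_measurable M" "Y \<in> borel_measurable M"
    and "distr M borel X = distr M borel Y"
  shows "Lp_norm M p X = Lp_norm M p Y"
proof -
  have "(\<integral>\<^sup>+ \<omega>. ennreal (\<bar>Z \<omega>\<bar> powr p) \<partial>M) = (\<integral>\<^sup>+ x. ennreal (\<bar>x\<bar> powr p) \<partial>distr M borel Z)"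
    if [measurable]: "Z \<in> borel_measurable M" for Z
    by (simp add: nn_integral_distr)
  then show ?thesis
    using assms by (simp add: Lp_norm_def)
qed

lemma centered_distr_cong:
  fixes X Y :: "'a \<Rightarrow> real"
  assumes "X \<in> borel_measurable M" "Y \<in> borel_measurable M"
    and "distr M borel X = distr M borel Y" and "centered M Y"
  shows "centered M X"
proof -
  have "integrable M Z \<longleftrightarrow> integrable (distr M borel Z) (\<lambda>x. x)"
    and "(\<integral>\<omega>. Z \<omega> \<partial>M) = (\<integral>x. x \<partial>distr M borel Z)" if "Z \<in> borel_measurable M" for Z :: "'a \<Rightarrow> real"
    using that by (simp_all add: integrable_distr_eq integral_distr)
  then show ?thesis
    using assms by (simp add: centered_def)
qed

lemma centered_cmult: "centered M X \<Longrightarrow> centered M (\<lambda>\<omega>. c * X \<omega>)"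
  by (simp add: centered_def)

lemma Lp_norm_cmult:
  assumes "p > 0" and "integrable M (\<lambda>\<omega>. \<bar>f \<omega>\<bar> powr p)"
  shows "Lp_norm M p (\<lambda>\<omega>. c * f \<omega>) = ennreal \<bar>c\<bar> * Lp_norm M p f"
proof -
  have "integrable M (\<lambda>\<omega>. \<bar>c * f \<omega>\<bar> powr p)"
    using assms by (simp add: abs_mult powr_mult)
  then show ?thesis
    using assms by (simp add: Lp_norm_eq_integral abs_mult powr_mult powr_powr integral_nonneg_AE
        flip: ennreal_mult)
qed

section \<open>Monotonicity of the norms in the exponent\<close>

text \<open>Jensen's inequality for the concave function \<open>x powr r\<close>, obtained by
  integrating its tangent line at the mean of \<open>g\<close>.\<close>

lemma (in prob_space) integral_powr_le:
  fixes g :: "'a \<Rightarrow> real"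
  assumes g: "integrable M g" "\<And>\<omega>. 0 \<le> g \<omega>" and r: "0 < r" "r \<le> 1"
  shows "integrable M (\<lambda>\<omega>. g \<omega> powr r)" and "(\<integral>\<omega>. g \<omega> powr r \<partial>M) \<le> (\<integral>\<omega>. g \<omega> \<partial>M) powr r"
proof -
  note [measurable] = borel_measurable_integrable[OF g(1)]
  \<comment> \<open>The right side is the tangent line of \<open>x powr r\<close> at
    \<open>x = A\<close>. The bound is Young's inequality for \<open>x / A\<close> and
    \<open>1\<close> with weights \<open>r\<close> and \<open>1 - r\<close>, multiplied by
    \<open>A powr r\<close>.\<close>
  have tangent: "x powr r \<le> A powr r * (r * (x / A) + (1 - r))" if "0 < A" "0 \<le> x" for x A :: real
  proof (cases "x = 0")
    case False
    then have "(x / A) powr r * 1 powr (1 - r) \<le> r * (x / A) + (1 - r) * 1"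
      using that r by (intro Youngs_inequality_0) auto
    then have "A powr r * (x / A) powr r \<le> A powr r * (r * (x / A) + (1 - r))"
      by (intro mult_left_mono) auto
    then show ?thesis
      using that by (simp add: powr_divide)
  qed (use that r in simp)
  show int: "integrable M (\<lambda>\<omega>. g \<omega> powr r)"
  proof (rule Bochner_Integration.integrable_bound)
    show "integrable M (\<lambda>\<omega>. r * g \<omega> + (1 - r))"
      using g by simp
    \<comment> \<open>The tangent at \<open>A = 1\<close> is an affine majorant, integrable because
      the measure is finite.\<close>
    show "AE \<omega> in M. norm (g \<omega> powr r) \<le> norm (r * g \<omega> + (1 - r))"
      using tangent[of 1] g(2) r by (force intro: order_trans[OF _ abs_ge_self])
  qed simp
  let ?A = "\<integral>\<omega>. g \<omega> \<partial>M"
  have "?A \<ge> 0"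
    using g by simp
  then consider "?A = 0" | "?A > 0"
    by linarith
  then show "(\<integral>\<omega>. g \<omega> powr r \<partial>M) \<le> ?A powr r"
  proof cases
    \<comment> \<open>The tangent bound requires a positive base point. With mean zero,
      \<open>g\<close> vanishes almost everywhere and both sides are \<open>0\<close>.\<close>
    case 1
    then have "AE \<omega> in M. g \<omega> = 0"
      using g by (simp add: integral_nonneg_eq_0_iff_AE)
    then have "AE \<omega> in M. g \<omega> powr r = 0"
      by eventually_elim simp
    then show ?thesis
      by (simp add: integral_eq_zero_AE)
  next
    case 2
    have "(\<integral>\<omega>. g \<omega> powr r \<partial>M) \<le> (\<integral>\<omega>. ?A powr r * (r * (g \<omega> / ?A) + (1 - r)) \<partial>M)"
      using int g 2 tangent by (intro integral_mono) auto
    \<comment> \<open>The mean of \<open>g \<omega> / ?A\<close> is \<open>1\<close>, so the bracket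
      integrates to \<open>r + (1 - r) = 1\<close>.\<close>
    also have "\<dots> = ?A powr r"
      using g 2 by (simp add: prob_space)
    finally show ?thesis .
  qed
qed

text \<open>Lyapunov's inequality: Jensen applied to \<open>g = \<bar>f\<bar> powr q\<close> with
  exponent \<open>r = p / q\<close>.\<close>

lemma (in prob_space)
  assumes "0 < p" "p \<le> q" and int: "integrable M (\<lambda>\<omega>. \<bar>f \<omega>\<bar> powr q)"
  shows integrable_powr_mono: "integrable M (\<lambda>\<omega>. \<bar>f \<omega>\<bar> powr p)"
    and Lp_norm_mono: "Lp_norm M p f \<le> Lp_norm M q f"
proof -
  note * = integral_powr_le[OF int, of "p / q", simplified powr_powr]
  show int': "integrable M (\<lambda>\<omega>. \<bar>f \<omega>\<bar> powr p)"
    using *(1) assms by simp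
  have "(\<integral>\<omega>. \<bar>f \<omega>\<bar> powr p \<partial>M) \<le> (\<integral>\<omega>. \<bar>f \<omega>\<bar> powr q \<partial>M) powr (p / q)"
    using *(2) assms by simp
  then have "(\<integral>\<omega>. \<bar>f \<omega>\<bar> powr p \<partial>M) powr (1 / p) \<le> ((\<integral>\<omega>. \<bar>f \<omega>\<bar> powr q \<partial>M) powr (p / q)) powr (1 / p)"
    using assms by (intro powr_mono2) auto
  then show "Lp_norm M p f \<le> Lp_norm M q f"
    using assms int' by (simp add: Lp_norm_eq_integral powr_powr ennreal_leI)
qed

section \<open>Second moments of sums of independent centered variables\<close>

text \<open>Induction on \<open>I\<close>: the new summand is independent of the sum of the others
  and has mean zero, so the cross term integrates to zero. Integrability is carried along to split
  the integral of the expanded square.\<close>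

lemma (in prob_space) integral_sum_square_indep_centered:
  fixes X :: "'i \<Rightarrow> 'a \<Rightarrow> real"
  assumes "finite I" and "indep_vars (\<lambda>_. borel) X I"
    and "\<And>i. i \<in> I \<Longrightarrow> centered M (X i)" and "\<And>i. i \<in> I \<Longrightarrow> integrable M (\<lambda>\<omega>. (X i \<omega>)\<^sup>2)"
  shows "integrable M (\<lambda>\<omega>. (\<Sum>i\<in>I. X i \<omega>)\<^sup>2)"
    and "(\<integral>\<omega>. (\<Sum>i\<in>I. X i \<omega>)\<^sup>2 \<partial>M) = (\<Sum>i\<in>I. \<integral>\<omega>. (X i \<omega>)\<^sup>2 \<partial>M)"
proof -
  from assms have "integrable M (\<lambda>\<omega>. (\<Sum>i\<in>I. X i \<omega>)\<^sup>2) \<and>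
      (\<integral>\<omega>. (\<Sum>i\<in>I. X i \<omega>)\<^sup>2 \<partial>M) = (\<Sum>i\<in>I. \<integral>\<omega>. (X i \<omega>)\<^sup>2 \<partial>M)"
  proof (induction I)
    case (insert i I)
    let ?S = "\<lambda>\<omega>. \<Sum>i\<in>I. X i \<omega>"
    have IH: "integrable M (\<lambda>\<omega>. (?S \<omega>)\<^sup>2)"
        "(\<integral>\<omega>. (?S \<omega>)\<^sup>2 \<partial>M) = (\<Sum>i\<in>I. \<integral>\<omega>. (X i \<omega>)\<^sup>2 \<partial>M)"
      using insert.IH insert.prems indep_vars_subset[OF insert.prems(1), of I] by auto
    have indep: "indep_var borel (X i) borel ?S"
      using insert by (intro indep_vars_sum) auto
    have int: "integrable M (X i)" "integrable M ?S" and mean: "(\<integral>\<omega>. X i \<omega> \<partial>M) = 0"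
      using insert.prems by (auto simp: centered_def)
    \<comment> \<open>Independence alone makes the product of two integrable variables
      integrable.\<close>
    have int_mult: "integrable M (\<lambda>\<omega>. X i \<omega> * ?S \<omega>)"
      using indep int by (rule indep_var_integrable)
    have "(\<integral>\<omega>. X i \<omega> * ?S \<omega> \<partial>M) = 0"
      using indep_var_lebesgue_integral[OF indep int] mean by simp
    moreover have "(\<Sum>i\<in>insert i I. X i \<omega>)\<^sup>2 = (X i \<omega>)\<^sup>2 + (2 * (X i \<omega> * ?S \<omega>) + (?S \<omega>)\<^sup>2)" for \<omega>
      using insert.hyps by (simp add: power2_sum)
    ultimately show ?case
      using insert.prems(3)[of i] insert.hyps IH int_mult by simp
  qed simp
  then show "integrable M (\<lambda>\<omega>. (\<Sum>i\<in>I. X i \<omega>)\<^sup>2)"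
    and "(\<integral>\<omega>. (\<Sum>i\<in>I. X i \<omega>)\<^sup>2 \<partial>M) = (\<Sum>i\<in>I. \<integral>\<omega>. (X i \<omega>)\<^sup>2 \<partial>M)"
    by auto
qed

lemma Lp_norm_2_sq:
  assumes "integrable M (\<lambda>\<omega>. (f \<omega>)\<^sup>2)"
  shows "Lp_norm M 2 f = ennreal (sqrt (\<integral>\<omega>. (f \<omega>)\<^sup>2 \<partial>M))"
  using assms Lp_norm_eq_integral[of M f 2] by (simp add: powr_half_sqrt)

text \<open>The variances are \<open>(a i)\<^sup>2 * m\<^sup>2\<close>, and they add up to
  \<open>m\<^sup>2\<close> because \<open>a\<close> is a unit vector. Square integrability comes
  from the finiteness of the prescribed norms.\<close>

lemma (in prob_space) Lp_norm_2_sum_indep_centered: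
  fixes X :: "'i \<Rightarrow> 'a \<Rightarrow> real"
  assumes "finite I" and "indep_vars (\<lambda>_. borel) X I"
    and "\<And>i. i \<in> I \<Longrightarrow> centered M (X i)"
    and "\<And>i. i \<in> I \<Longrightarrow> Lp_norm M 2 (X i) = ennreal (\<bar>a i\<bar> * m)"
    and "(\<Sum>i\<in>I. (a i)\<^sup>2) = 1" and "m \<ge> 0"
  shows "Lp_norm M 2 (\<lambda>\<omega>. \<Sum>i\<in>I. X i \<omega>) = ennreal m"
proof -
  have int: "integrable M (\<lambda>\<omega>. (X i \<omega>)\<^sup>2)" if "i \<in> I" for i
    using integrable_powr_if_Lp_norm_finite[of "X i" M 2] assms(3,4)[OF that]
    by (simp add: centered_def borel_measurable_integrable)
  have "(\<integral>\<omega>. (X i \<omega>)\<^sup>2 \<partial>M) = (a i)\<^sup>2 * m\<^sup>2" if "i \<in> I" for i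
  proof -
    have "sqrt (\<integral>\<omega>. (X i \<omega>)\<^sup>2 \<partial>M) = \<bar>a i\<bar> * m"
      using Lp_norm_2_sq[OF int[OF that]] assms(4)[OF that] \<open>m \<ge> 0\<close> by simp
    then have "(\<integral>\<omega>. (X i \<omega>)\<^sup>2 \<partial>M) = (\<bar>a i\<bar> * m)\<^sup>2"
      by (metis real_sqrt_pow2 integral_nonneg_AE AE_I2 zero_le_power2)
    then show ?thesis
      by (simp add: power_mult_distrib)
  qed
  then have "(\<integral>\<omega>. (\<Sum>i\<in>I. X i \<omega>)\<^sup>2 \<partial>M) = m\<^sup>2"
    using integral_sum_square_indep_centered(2)[OF assms(1-3) int] assms(5)
    by (simp flip: sum_distrib_right)
  then show ?thesis
    using Lp_norm_2_sq[OF integral_sum_square_indep_centered(1)[OF assms(1-3) int]] \<open>m \<ge> 0\<close> by simp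
qed

section \<open>The weighted sum at a fixed exponent\<close>

text \<open>Each coordinate of a unit vector satisfies \<open>\<bar>a i\<bar> \<le> 1\<close>, so
  raising the exponent from \<open>2\<close> to \<open>p\<close> can only decrease its
  power.\<close>

lemma sum_abs_powr_le_one:
  fixes a :: "'i \<Rightarrow> real"
  assumes "finite I" "(\<Sum>i\<in>I. (a i)\<^sup>2) = 1" "p \<ge> 2"
  shows "(\<Sum>i\<in>I. \<bar>a i\<bar> powr p) \<le> 1"
proof -
  have "\<bar>a i\<bar> powr p \<le> (a i)\<^sup>2" if "i \<in> I" for i
  proof -
    have "(a i)\<^sup>2 \<le> 1"
      using member_le_sum[of i I "\<lambda>i. (a i)\<^sup>2"] assms that by simp
    then have "\<bar>a i\<bar> \<le> 1"
      by (simp add: abs_square_le_1)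
    then have "\<bar>a i\<bar> powr p \<le> \<bar>a i\<bar> powr 2"
      using assms by (intro powr_mono') auto
    then show ?thesis
      by simp
  qed
  then have "(\<Sum>i\<in>I. \<bar>a i\<bar> powr p) \<le> (\<Sum>i\<in>I. (a i)\<^sup>2)"
    by (rule sum_mono)
  then show ?thesis
    using assms by simp
qed

text \<open>The theorem at one exponent \<open>p\<close>, before division by \<open>psi_R\<close>.
  Both terms of the maximum are compared with the real number \<open>m\<close>, the
  \<open>p\<close>-norm of \<open>\<xi>\<close>.\<close>

lemma (in prob_space) Rosenthal_weighted_copies:
  fixes X :: "nat \<Rightarrow> 'a \<Rightarrow> real"
  assumes C: "Rosenthal_constant M C" and p: "p \<ge> 2" and n: "n \<ge> 1" and a: "(\<Sum>k=1..n. (a k)\<^sup>2) = 1"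
    and \<xi>: "centered M \<xi>" "Lp_norm M p \<xi> < \<infinity>"
    and X: "indep_vars (\<lambda>_. borel) X {1..n}"
    and distr: "\<And>k. k \<in> {1..n} \<Longrightarrow> distr M borel (X k) = distr M borel \<xi>"
  shows "Lp_norm M p (\<lambda>\<omega>. \<Sum>k=1..n. a k * X k \<omega>)
    \<le> ennreal (C * (p / (exp 1 * ln p))) * Lp_norm M p \<xi>"
proof -
  have [measurable]: "\<xi> \<in> borel_measurable M"
    using \<xi> by (auto simp: centered_def)
  have X_meas: "X k \<in> borel_measurable M" if "k \<in> {1..n}" for k
    using X that by (auto simp: indep_vars_def)
  have \<xi>_int: "integrable M (\<lambda>\<omega>. \<bar>\<xi> \<omega>\<bar> powr p)"
    using \<xi> by (intro integrable_powr_if_Lp_norm_finite) auto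
  have norm_X: "Lp_norm M q (X k) = Lp_norm M q \<xi>" if "k \<in> {1..n}" for q k
    using that X_meas distr by (intro Lp_norm_distr_cong) auto
  \<comment> \<open>Stated for a range of exponents because the first term of the maximum uses
    \<open>q = 2\<close> and the second uses \<open>q = p\<close>.\<close>
  have norm_aX: "Lp_norm M q (\<lambda>\<omega>. a k * X k \<omega>) = ennreal \<bar>a k\<bar> * Lp_norm M q \<xi>"
    if "k \<in> {1..n}" "0 < q" "q \<le> p" for q k
  proof -
    have "Lp_norm M q \<xi> < \<infinity>"
      using Lp_norm_mono[OF that(2,3) \<xi>_int] \<xi>(2) by (rule le_less_trans)
    then have "integrable M (\<lambda>\<omega>. \<bar>X k \<omega>\<bar> powr q)"
      using that X_meas by (intro integrable_powr_if_Lp_norm_finite) (auto simp: norm_X)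
    then show ?thesis
      using that by (simp add: Lp_norm_cmult norm_X)
  qed
  obtain m where m: "m \<ge> 0" "Lp_norm M p \<xi> = ennreal m"
    using \<xi>(2) by (cases "Lp_norm M p \<xi>") auto
  have mono: "Lp_norm M 2 \<xi> \<le> ennreal m"
    using Lp_norm_mono[OF _ p \<xi>_int] m by simp
  then obtain s where s: "s \<ge> 0" "Lp_norm M 2 \<xi> = ennreal s"
    by (cases "Lp_norm M 2 \<xi>") (auto simp: top_unique)
  let ?\<eta> = "\<lambda>k \<omega>. a k * X k \<omega>"
  have indep: "indep_vars (\<lambda>_. borel) ?\<eta> {1..n}"
    using X by (rule indep_vars_compose2) simp
  have centered: "centered M (?\<eta> k)" if "k \<in> {1..n}" for k
    using that X_meas distr \<xi>(1) by (auto intro!: centered_cmult[OF centered_distr_cong[where Y=\<xi>]])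
  have fin: "Lp_norm M p (?\<eta> k) < \<infinity>" if "k \<in> {1..n}" for k
    using norm_aX[OF that, of p] p m by (simp add: ennreal_mult_less_top)
  have "Lp_norm M 2 (\<lambda>\<omega>. \<Sum>k=1..n. ?\<eta> k \<omega>) = ennreal s"
    using indep centered norm_aX[of _ 2] p s a
    by (intro Lp_norm_2_sum_indep_centered[where a=a]) (auto simp: ennreal_mult)
  then have first: "Lp_norm M 2 (\<lambda>\<omega>. \<Sum>k=1..n. ?\<eta> k \<omega>) \<le> ennreal m"
    using mono s by simp
  have "epowr (Lp_norm M p (?\<eta> k)) p = ennreal (\<bar>a k\<bar> powr p * m powr p)" if "k \<in> {1..n}" for k
    using norm_aX[OF that, of p] p m by (simp add: epowr_ennreal powr_mult flip: ennreal_mult)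
  then have "(\<Sum>k=1..n. epowr (Lp_norm M p (?\<eta> k)) p) = ennreal ((\<Sum>k=1..n. \<bar>a k\<bar> powr p) * m powr p)"
    by (simp add: sum_distrib_right)
  then have "epowr (\<Sum>k=1..n. epowr (Lp_norm M p (?\<eta> k)) p) (1 / p)
      = ennreal (((\<Sum>k=1..n. \<bar>a k\<bar> powr p) * m powr p) powr (1 / p))"
    by (simp add: epowr_ennreal sum_nonneg)
  \<comment> \<open>Here the sum of the \<open>\<bar>a k\<bar> powr p\<close> is replaced by its
    bound \<open>1\<close>; the outer power \<open>1 / p\<close> is monotone.\<close>
  also have "\<dots> \<le> ennreal ((1 * m powr p) powr (1 / p))"
    using sum_abs_powr_le_one[OF _ a p] p
    by (intro ennreal_leI powr_mono2 mult_right_mono) (auto simp: sum_nonneg)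
  also have "\<dots> = ennreal m"
    using p m by (simp add: powr_powr)
  finally have second: "epowr (\<Sum>k=1..n. epowr (Lp_norm M p (?\<eta> k)) p) (1 / p) \<le> ennreal m" .
  have "Lp_norm M p (\<lambda>\<omega>. \<Sum>k=1..n. ?\<eta> k \<omega>) \<le> ennreal (C * (p / (exp 1 * ln p))) *
      max (Lp_norm M 2 (\<lambda>\<omega>. \<Sum>k=1..n. ?\<eta> k \<omega>))
        (epowr (\<Sum>k=1..n. epowr (Lp_norm M p (?\<eta> k)) p) (1 / p))"
    using C p n indep centered fin unfolding Rosenthal_constant_def by blast
  also have "\<dots> \<le> ennreal (C * (p / (exp 1 * ln p))) * ennreal m"
    using first second by (intro mult_left_mono) auto
  finally show ?thesis
    using m by simp
qed

theorem theorem5p1: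
  fixes M :: "'a measure" and C\<^sub>R :: real and \<psi> :: "real \<Rightarrow> real"
    and \<xi> :: "'a \<Rightarrow> real" and X :: "nat \<Rightarrow> 'a \<Rightarrow> real"
  assumes "prob_space M"
    and "Rosenthal_constant M C\<^sub>R"
    and "generating_function \<psi>"
    and "centered M \<xi>"
    and "\<xi> \<in> GLS M \<psi>"
    and "prob_space.indep_vars M (\<lambda>_. borel) X {1..}"
    and "\<And>k. k \<ge> 1 \<Longrightarrow> distr M borel (X k) = distr M borel \<xi>"
  shows "(SUP n\<in>{1..}. SUP a\<in>D n. GLS_norm M (psi_R C\<^sub>R \<psi>) (\<lambda>\<omega>. \<Sum>k=1..n. a k * X k \<omega>))
           \<le> GLS_norm M \<psi> \<xi>"
proof -
  interpret prob_space M
    by (rule assms(1))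
  have "Lp_norm M p (\<lambda>\<omega>. \<Sum>k=1..n. a k * X k \<omega>) / ennreal (psi_R C\<^sub>R \<psi> p) \<le> GLS_norm M \<psi> \<xi>"
    if n: "n \<ge> 1" and a: "a \<in> D n" and p: "p \<ge> 2" for n a p
  proof -
    define K where "K = C\<^sub>R * (p / (exp 1 * ln p))"
    have "C\<^sub>R > 0"
      using assms(2) unfolding Rosenthal_constant_def by (rule conjunct1)
    \<comment> \<open>Since \<open>p \<ge> 2\<close>, \<open>ln p\<close> is positive.\<close>
    then have "K > 0"
      using p by (simp add: K_def)
    have "\<psi> p > 0"
      using assms(3) p by (simp add: generating_function_def)
    have le_GLS: "Lp_norm M p \<xi> / ennreal (\<psi> p) \<le> GLS_norm M \<psi> \<xi>"
      unfolding GLS_norm_def using p by (intro SUP_upper) simp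
    also have "\<dots> < \<infinity>"
      using assms(5) by (simp add: GLS_def)
    \<comment> \<open>Dividing \<open>\<top>\<close> by the finite number \<open>\<psi> p\<close>
      would give \<open>\<top>\<close>, so a finite quotient has a finite numerator.\<close>
    finally have "Lp_norm M p \<xi> < \<infinity>"
      by (cases "Lp_norm M p \<xi>") (simp_all add: ennreal_top_divide)
    then obtain m where m: "m \<ge> 0" "Lp_norm M p \<xi> = ennreal m"
      by (cases "Lp_norm M p \<xi>") auto
    have "Lp_norm M p (\<lambda>\<omega>. \<Sum>k=1..n. a k * X k \<omega>) \<le> ennreal K * Lp_norm M p \<xi>"
      unfolding K_def
    proof (rule Rosenthal_weighted_copies[OF assms(2) p n _ assms(4) \<open>Lp_norm M p \<xi> < \<infinity>\<close>])
      show "(\<Sum>k=1..n. (a k)\<^sup>2) = 1"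
        using a by (simp add: D_def)
      show "indep_vars (\<lambda>_. borel) X {1..n}"
        by (rule indep_vars_subset[OF assms(6)]) auto
      show "distr M borel (X k) = distr M borel \<xi>" if "k \<in> {1..n}" for k
        using that by (intro assms(7)) simp
    qed
    then have "Lp_norm M p (\<lambda>\<omega>. \<Sum>k=1..n. a k * X k \<omega>) / ennreal (psi_R C\<^sub>R \<psi> p)
        \<le> ennreal K * Lp_norm M p \<xi> / ennreal (psi_R C\<^sub>R \<psi> p)"
      by (rule divide_right_mono_ennreal)
    also have "\<dots> = ennreal (K * m) / ennreal (K * \<psi> p)"
      using m \<open>K > 0\<close> by (simp only: psi_R_def K_def ennreal_mult less_imp_le)
    \<comment> \<open>Both numerator and denominator are now real, and the positive factor
      \<open>K\<close> cancels.\<close>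
    also have "\<dots> = Lp_norm M p \<xi> / ennreal (\<psi> p)"
      using \<open>K > 0\<close> \<open>\<psi> p > 0\<close> m by (simp add: divide_ennreal)
    finally show ?thesis
      using le_GLS by (rule order_trans)
  qed
  then have "GLS_norm M (psi_R C\<^sub>R \<psi>) (\<lambda>\<omega>. \<Sum>k=1..n. a k * X k \<omega>) \<le> GLS_norm M \<psi> \<xi>"
    if "n \<ge> 1" "a \<in> D n" for n a
    unfolding GLS_norm_def[of M "psi_R C\<^sub>R \<psi>"] using that by (intro SUP_least) simp
  then show ?thesis
    by (intro SUP_least) simp
qed

end
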